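(* Let $A$ and $B$ be quantifier-free symbolic heaps of array separation logic, written $$A=\Pi:\mathop{*}_{i=1}^n\mathsf{array}(a_i,b_i)*\mathop{*}_{i=1}^k t_i\mapsto u_i,\qquad B=\Pi':\mathop{*}_{i=1}^m\mathsf{array}(c_i,d_i)*\mathop{*}_{i=1}^{\ell} v_i\mapsto w_i.$$ If $\beta(A,B)$ is satisfiable, then there exists a solution seed for $(A,B)$.
   Context: ASL: terms $t ::= x\mid n\mid t+t\mid n t$ over variables and $n\in\mathbb{N}$; pure formulas are conjunctions of $t=t,t\neq t,t\le t,t<t$; spatial formulas $F::=\mathsf{emp}\mid t\mapsto t\mid\mathsf{array}(t,t)\mid F*F$. Pure formulas are evaluated over $\mathbb{N}$ by stacks $s:\mathsf{Var}\to\mathbb{N}$. For quantifier-free $C$, $\lfloor C\rfloor$ replaces every $c\mapsto d$ by $\mathsf{array}(c,c)$; if $\lfloor C\rfloor=\Pi:\mathop{*}_{i=1}^N\mathsf{array}(\hat a_i,\hat b_i)$ then $\gamma(C)=\Pi\wedge\bigwedge_{i}\hat a_i\le\hat b_i\wedge\bigwedge_{i<j}((\hat b_i<\hat a_j)\vee(\hat b_j<\hat a_i))$. Define $\beta(A,B)=\gamma(A)\wedge\gamma(B)\wedge\bigwedge_{j=1}^{\ell}\bigwedge_{i=1}^{n}(v_j<a_i\vee v_j>b_i)\wedge\bigwedge_{i=1}^{k}\bigwedge_{j=1}^{\ell}(t_i\neq v_j\vee u_i=w_j)$. Let $T(A,B)$ be the set of all terms occurring in $A$ or $B$ together with the terms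 $b_i+1$ ($i\le n$), $d_i+1$ ($i\le m$), $t_i+1$ ($i\le k$), $v_i+1$ ($i\le \ell$). A solution seed for $(A,B)$ is a pure formula $\Delta=\bigwedge_{i\in I}\delta_i$ such that: (1) $\Delta$ is satisfiable and $\Delta\models\beta(A,B)$ (every stack satisfying $\Delta$ satisfies $\beta(A,B)$); (2) each $\delta_i$ is of the form $t<u$ or $t=u$ with $t,u\in T(A,B)$; (3) for all $t,u\in T(A,B)$ some $\delta_i$ is $t<u$, $u<t$ or $t=u$. *)

theory Defs
  imports Main
begin

datatype 'v trm =
    Var 'v
  | Const nat
  | Plus "'v trm" "'v trm"
  | Scale nat "'v trm"

type_synonym 'v stack = "'v \<Rightarrow> nat"

primrec eval_trm :: "'v stack \<Rightarrow> 'v trm \<Rightarrow> nat" where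
  "eval_trm s (Var x) = s x"
| "eval_trm s (Const n) = n"
| "eval_trm s (Plus t u) = eval_trm s t + eval_trm s u"
| "eval_trm s (Scale n t) = n * eval_trm s t"

datatype 'v atom =
    Eq "'v trm" "'v trm"
  | Neq "'v trm" "'v trm"
  | Le "'v trm" "'v trm"
  | Lt "'v trm" "'v trm"

primrec sat_atom :: "'v stack \<Rightarrow> 'v atom \<Rightarrow> bool" where
  "sat_atom s (Eq t u) \<longleftrightarrow> eval_trm s t = eval_trm s u"
| "sat_atom s (Neq t u) \<longleftrightarrow> eval_trm s t \<noteq> eval_trm s u"
| "sat_atom s (Le t u) \<longleftrightarrow> eval_trm s t \<le> eval_trm s u"
| "sat_atom s (Lt t u) \<longleftrightarrow> eval_trm s t < eval_trm s u"

text \<open>A pure formula is the conjunction of a finite list of atoms; the empty list is truth.\<close>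

type_synonym 'v pure = "'v atom list"

text \<open>The formulas \<open>\<gamma>\<close> and \<open>\<beta>\<close> below contain disjunctions and so are not
  pure formulas; they live in this larger class.\<close>

datatype 'v fml =
    Atom "'v atom"
  | Conj "'v fml list"
  | Disj "'v fml list"

fun sat :: "'v stack \<Rightarrow> 'v fml \<Rightarrow> bool" where
  "sat s (Atom a) \<longleftrightarrow> sat_atom s a"
| "sat s (Conj \<phi>s) \<longleftrightarrow> (\<forall>\<phi> \<in> set \<phi>s. sat s \<phi>)"
| "sat s (Disj \<phi>s) \<longleftrightarrow> (\<exists>\<phi> \<in> set \<phi>s. sat s \<phi>)"

definition pure_fml :: "'v pure \<Rightarrow> 'v fml" where
  "pure_fml \<Pi> = Conj (map Atom \<Pi>)"

definition satisfiable :: "'v fml \<Rightarrow> bool" where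
  "satisfiable \<phi> \<longleftrightarrow> (\<exists>s. sat s \<phi>)"

definition entails :: "'v fml \<Rightarrow> 'v fml \<Rightarrow> bool" where
  "entails \<phi> \<psi> \<longleftrightarrow> (\<forall>s. sat s \<phi> \<longrightarrow> sat s \<psi>)"

datatype 'v spatial =
    Emp
  | PointsTo "'v trm" "'v trm"
  | Array "'v trm" "'v trm"
  | Star "'v spatial" "'v spatial"

datatype 'v heap = Heap (pure_part: "'v pure") (spatial_part: "'v spatial")

text \<open>Up to associativity and commutativity of \<open>*\<close> and the unit laws for \<open>Emp\<close>, every
  spatial formula is an iterated \<open>*\<close> of arrays and points-to assertions.  The next two functions
  list the pairs \<open>(a\<^sub>i, b\<^sub>i)\<close> and \<open>(t\<^sub>i, u\<^sub>i)\<close> of this decomposition.\<close>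

primrec arrays :: "'v spatial \<Rightarrow> ('v trm \<times> 'v trm) list" where
  "arrays Emp = []"
| "arrays (PointsTo t u) = []"
| "arrays (Array a b) = [(a, b)]"
| "arrays (Star F G) = arrays F @ arrays G"

primrec pointers :: "'v spatial \<Rightarrow> ('v trm \<times> 'v trm) list" where
  "pointers Emp = []"
| "pointers (PointsTo t u) = [(t, u)]"
| "pointers (Array a b) = []"
| "pointers (Star F G) = pointers F @ pointers G"

primrec floor_spatial :: "'v spatial \<Rightarrow> 'v spatial" where
  "floor_spatial Emp = Emp"
| "floor_spatial (PointsTo c d) = Array c c"
| "floor_spatial (Array a b) = Array a b"
| "floor_spatial (Star F G) = Star (floor_spatial F) (floor_spatial G)"

definition floor_heap :: "'v heap \<Rightarrow> 'v heap" where
  "floor_heap C = Heap (pure_part C) (floor_spatial (spatial_part C))"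

definition gamma :: "'v heap \<Rightarrow> 'v fml" where
  "gamma C =
    (let L = arrays (spatial_part (floor_heap C)); N = length L;
         a = (\<lambda>i. fst (L ! i)); b = (\<lambda>i. snd (L ! i))
     in Conj
       [pure_fml (pure_part (floor_heap C)),
        Conj [Atom (Le (a i) (b i)). i \<leftarrow> [0..<N]],
        Conj [Disj [Atom (Lt (b i) (a j)), Atom (Lt (b j) (a i))].
                i \<leftarrow> [0..<N], j \<leftarrow> [Suc i..<N]]])"

definition beta :: "'v heap \<Rightarrow> 'v heap \<Rightarrow> 'v fml" where
  "beta A B = Conj
    [gamma A,
     gamma B,
     Conj [Disj [Atom (Lt v a), Atom (Lt b v)].
             (v, w) \<leftarrow> pointers (spatial_part B), (a, b) \<leftarrow> arrays (spatial_part A)],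
     Conj [Disj [Atom (Neq t v), Atom (Eq u w)].
             (t, u) \<leftarrow> pointers (spatial_part A), (v, w) \<leftarrow> pointers (spatial_part B)]]"

text \<open>A term occurs in a heap whenever it occurs as a subterm.  The coefficient \<open>n\<close> of
  \<open>Scale n t\<close> is a number rather than a term.\<close>

primrec subterms :: "'v trm \<Rightarrow> 'v trm set" where
  "subterms (Var x) = {Var x}"
| "subterms (Const n) = {Const n}"
| "subterms (Plus t u) = insert (Plus t u) (subterms t \<union> subterms u)"
| "subterms (Scale n t) = insert (Scale n t) (subterms t)"

primrec terms_atom :: "'v atom \<Rightarrow> 'v trm set" where
  "terms_atom (Eq t u) = subterms t \<union> subterms u"
| "terms_atom (Neq t u) = subterms t \<union> subterms u"
| "terms_atom (Le t u) = subterms t \<union> subterms u"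
| "terms_atom (Lt t u) = subterms t \<union> subterms u"

primrec terms_spatial :: "'v spatial \<Rightarrow> 'v trm set" where
  "terms_spatial Emp = {}"
| "terms_spatial (PointsTo t u) = subterms t \<union> subterms u"
| "terms_spatial (Array a b) = subterms a \<union> subterms b"
| "terms_spatial (Star F G) = terms_spatial F \<union> terms_spatial G"

definition terms_heap :: "'v heap \<Rightarrow> 'v trm set" where
  "terms_heap C = (\<Union>\<alpha> \<in> set (pure_part C). terms_atom \<alpha>) \<union> terms_spatial (spatial_part C)"

abbreviation succ_trm :: "'v trm \<Rightarrow> 'v trm" where
  "succ_trm t \<equiv> Plus t (Const 1)"

definition seed_terms :: "'v heap \<Rightarrow> 'v heap \<Rightarrow> 'v trm set" where
  "seed_terms A B = terms_heap A \<union> terms_heap B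
    \<union> {succ_trm b | a b. (a, b) \<in> set (arrays (spatial_part A))}
    \<union> {succ_trm d | c d. (c, d) \<in> set (arrays (spatial_part B))}
    \<union> {succ_trm t | t u. (t, u) \<in> set (pointers (spatial_part A))}
    \<union> {succ_trm v | v w. (v, w) \<in> set (pointers (spatial_part B))}"

definition solution_seed :: "'v heap \<Rightarrow> 'v heap \<Rightarrow> 'v pure \<Rightarrow> bool" where
  "solution_seed A B \<Delta> \<longleftrightarrow>
     satisfiable (pure_fml \<Delta>) \<and> entails (pure_fml \<Delta>) (beta A B) \<and>
     (\<forall>\<delta> \<in> set \<Delta>. \<exists>t \<in> seed_terms A B. \<exists>u \<in> seed_terms A B. \<delta> = Lt t u \<or> \<delta> = Eq t u) \<and>
     (\<forall>t \<in> seed_terms A B. \<forall>u \<in> seed_terms A B.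
        \<exists>\<delta> \<in> set \<Delta>. \<delta> = Lt t u \<or> \<delta> = Lt u t \<or> \<delta> = Eq t u)"

end

theory Submission
  imports Defs
begin

text \<open>Fix a stack satisfying \<open>\<beta>(A, B)\<close> and let \<open>\<Delta>\<close> be its order diagram on the finite set
  \<open>T(A, B)\<close>: all atoms \<open>t < u\<close> and \<open>t = u\<close> over \<open>T(A, B)\<close> that it satisfies. A stack satisfying
  \<open>\<Delta>\<close> orders \<open>T(A, B)\<close> in the same way, and the truth of \<open>\<beta>(A, B)\<close> depends only on this order
  because every atom of \<open>\<beta>(A, B)\<close> compares two terms of \<open>T(A, B)\<close>.\<close>

text \<open>Only the two sides of a comparison are collected, not their proper subterms: a stack
  affects the truth of an atom only through the values of these sides.\<close>

primrec atom_args :: "'v atom \<Rightarrow> 'v trm set" where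
  "atom_args (Eq t u) = {t, u}"
| "atom_args (Neq t u) = {t, u}"
| "atom_args (Le t u) = {t, u}"
| "atom_args (Lt t u) = {t, u}"

fun fml_args :: "'v fml \<Rightarrow> 'v trm set" where
  "fml_args (Atom a) = atom_args a"
| "fml_args (Conj \<phi>s) = (\<Union>\<phi> \<in> set \<phi>s. fml_args \<phi>)"
| "fml_args (Disj \<phi>s) = (\<Union>\<phi> \<in> set \<phi>s. fml_args \<phi>)"

text \<open>Strict comparison suffices: two values are equal iff neither is below the other, and
  \<open>t\<close> is at most \<open>u\<close> iff \<open>u\<close> is not below
  \<open>t\<close>.\<close>

definition same_order :: "'v trm set \<Rightarrow> 'v stack \<Rightarrow> 'v stack \<Rightarrow> bool" where
  "same_order T s s' \<longleftrightarrow>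
     (\<forall>t \<in> T. \<forall>u \<in> T. eval_trm s t < eval_trm s u \<longleftrightarrow> eval_trm s' t < eval_trm s' u)"

lemma sat_atom_same_order:
  assumes "same_order T s s'" "atom_args a \<subseteq> T"
  shows "sat_atom s a \<longleftrightarrow> sat_atom s' a"
proof -
  have "eval_trm s t < eval_trm s u \<longleftrightarrow> eval_trm s' t < eval_trm s' u"
    and "eval_trm s t = eval_trm s u \<longleftrightarrow> eval_trm s' t = eval_trm s' u"
    if "t \<in> T" "u \<in> T" for t u
    using assms(1) that unfolding same_order_def by (blast, metis linorder_neq_iff)
  then show ?thesis
    using assms(2) by (cases a) (simp_all add: linorder_not_less [symmetric] del: linorder_not_less)
qed

lemma sat_same_order:
  assumes "same_order T s s'" "fml_args \<phi> \<subseteq> T"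
  shows "sat s \<phi> \<longleftrightarrow> sat s' \<phi>"
  using assms(2)
proof (induction \<phi>)
  case (Atom a)
  then show ?case using sat_atom_same_order [OF assms(1)] by simp
qed (simp_all add: UN_subset_iff cong: ball_cong bex_cong)

lemma subterms_refl: "t \<in> subterms t"
  by (cases t) auto

lemma finite_subterms: "finite (subterms t)"
  by (induction t) auto

lemma finite_terms_heap: "finite (terms_heap C)"
proof -
  have "finite (terms_atom \<alpha>)" for \<alpha> :: "'a atom"
    by (cases \<alpha>) (auto simp: finite_subterms)
  moreover have "finite (terms_spatial F)" for F :: "'a spatial"
    by (induction F) (auto simp: finite_subterms)
  ultimately show ?thesis
    by (simp add: terms_heap_def)
qed

text \<open>A pure formula is a finite list of atoms, so finiteness of this set is what makes the
  order diagram a formula.\<close>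

lemma finite_seed_terms: "finite (seed_terms A B)"
proof -
  have "finite {succ_trm y | x y. (x, y) \<in> set L}"
    and "finite {succ_trm x | x y. (x, y) \<in> set L}" for L :: "('a trm \<times> 'a trm) list"
    by (rule finite_subset [of _ "(succ_trm \<circ> snd) ` set L"], force, simp)
      (rule finite_subset [of _ "(succ_trm \<circ> fst) ` set L"], force, simp)
  then show ?thesis
    by (simp add: seed_terms_def finite_terms_heap)
qed

lemma arrays_terms_spatial:
  "(a, b) \<in> set (arrays F) \<Longrightarrow> a \<in> terms_spatial F \<and> b \<in> terms_spatial F"
  by (induction F) (auto simp: subterms_refl)

lemma pointers_terms_spatial:
  "(t, u) \<in> set (pointers F) \<Longrightarrow> t \<in> terms_spatial F \<and> u \<in> terms_spatial F"
  by (induction F) (auto simp: subterms_refl)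

text \<open>Replacing \<open>PointsTo c d\<close> by \<open>Array c c\<close> introduces no term but
  may lose \<open>d\<close>, hence an inclusion only.\<close>

lemma terms_floor_spatial: "terms_spatial (floor_spatial F) \<subseteq> terms_spatial F"
  by (induction F) auto

lemma atom_args_subset_terms_atom: "atom_args \<alpha> \<subseteq> terms_atom \<alpha>"
  by (cases \<alpha>) (auto simp: subterms_refl)

text \<open>The bounds compared in \<open>gamma C\<close> come from the floored heap, and flooring
  creates no new terms.\<close>

lemma fml_args_gamma: "fml_args (gamma C) \<subseteq> terms_heap C"
proof -
  define L where "L = arrays (floor_spatial (spatial_part C))"
  have L: "fst (L ! i) \<in> terms_heap C" "snd (L ! i) \<in> terms_heap C" if "i < length L" for i
  proof -
    have "(fst (L ! i), snd (L ! i)) \<in> set (arrays (floor_spatial (spatial_part C)))"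
      using that by (simp add: L_def)
    from arrays_terms_spatial [OF this] show "fst (L ! i) \<in> terms_heap C" "snd (L ! i) \<in> terms_heap C"
      using terms_floor_spatial by (auto simp: terms_heap_def)
  qed
  have "fml_args (pure_fml (pure_part C)) \<subseteq> terms_heap C"
    using atom_args_subset_terms_atom by (fastforce simp: pure_fml_def terms_heap_def)
  then show ?thesis
    by (auto simp: gamma_def floor_heap_def Let_def L_def [symmetric] intro!: L)
qed

lemma fml_args_beta: "fml_args (beta A B) \<subseteq> terms_heap A \<union> terms_heap B"
proof -
  have arr: "a \<in> terms_heap C \<and> b \<in> terms_heap C"
    if "(a, b) \<in> set (arrays (spatial_part C))" for a b and C :: "'a heap"
    using arrays_terms_spatial [OF that] by (simp add: terms_heap_def)
  have ptr: "t \<in> terms_heap C \<and> u \<in> terms_heap C"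
    if "(t, u) \<in> set (pointers (spatial_part C))" for t u and C :: "'a heap"
    using pointers_terms_spatial [OF that] by (simp add: terms_heap_def)
  show ?thesis
    using fml_args_gamma [of A] fml_args_gamma [of B] by (auto simp: beta_def dest!: arr ptr)
qed

text \<open>There are finitely many pairs over \<open>T\<close> and two candidate atoms for each;
  any enumeration of the true ones serves as \<Delta>.\<close>

lemma finite_order_diagram:
  assumes "finite T"
  obtains \<Delta> where
    "set \<Delta> = {\<delta>. (\<exists>t \<in> T. \<exists>u \<in> T. \<delta> = Lt t u \<or> \<delta> = Eq t u) \<and> sat_atom s \<delta>}"
proof -
  have "{\<delta>. (\<exists>t \<in> T. \<exists>u \<in> T. \<delta> = Lt t u \<or> \<delta> = Eq t u) \<and> sat_atom s \<delta>}
      \<subseteq> case_prod Lt ` (T \<times> T) \<union> case_prod Eq ` (T \<times> T)"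
    by auto
  then have "finite {\<delta>. (\<exists>t \<in> T. \<exists>u \<in> T. \<delta> = Lt t u \<or> \<delta> = Eq t u) \<and> sat_atom s \<delta>}"
    by (rule finite_subset) (simp add: assms)
  then show ?thesis
    by (auto dest!: finite_list intro: that)
qed

theorem theorem23:
  fixes A B :: "'v heap"
  assumes "satisfiable (beta A B)"
  shows "\<exists>\<Delta> :: 'v pure. solution_seed A B \<Delta>"
proof -
  define T where "T = seed_terms A B"
  obtain s where s: "sat s (beta A B)"
    using assms by (auto simp: satisfiable_def)
  obtain \<Delta> where \<Delta>:
    "set \<Delta> = {\<delta>. (\<exists>t \<in> T. \<exists>u \<in> T. \<delta> = Lt t u \<or> \<delta> = Eq t u) \<and> sat_atom s \<delta>}"
    using finite_order_diagram [OF finite_seed_terms] unfolding T_def by blast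
  have sat_\<Delta>: "sat s' (pure_fml \<Delta>) \<longleftrightarrow> (\<forall>\<delta> \<in> set \<Delta>. sat_atom s' \<delta>)" for s'
    by (simp add: pure_fml_def)
  have "same_order T s s'" if "sat s' (pure_fml \<Delta>)" for s'
    unfolding same_order_def
  proof (intro ballI)
    fix t u assume tu: "t \<in> T" "u \<in> T"
    have mem: "Lt t u \<in> set \<Delta> \<longleftrightarrow> eval_trm s t < eval_trm s u"
      "Lt u t \<in> set \<Delta> \<longleftrightarrow> eval_trm s u < eval_trm s t"
      "Eq t u \<in> set \<Delta> \<longleftrightarrow> eval_trm s t = eval_trm s u"
      using tu by (auto simp: \<Delta>)
    have sat: "\<forall>\<delta> \<in> set \<Delta>. sat_atom s' \<delta>"
      using that sat_\<Delta> by blast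
    \<comment> \<open>By trichotomy at \<open>s\<close>, one of the three atoms lies in \<Delta>. It
      also holds at \<open>s'\<close> and excludes the other two there, which gives both
      directions.\<close>
    show "eval_trm s t < eval_trm s u \<longleftrightarrow> eval_trm s' t < eval_trm s' u"
      using mem bspec [OF sat, of "Lt t u"] bspec [OF sat, of "Lt u t"] bspec [OF sat, of "Eq t u"]
      by (cases "eval_trm s t" "eval_trm s u" rule: linorder_cases) auto
  qed
  moreover have "fml_args (beta A B) \<subseteq> T"
    using fml_args_beta by (fastforce simp: T_def seed_terms_def)
  \<comment> \<open>The truth of \<open>beta A B\<close> is carried over from \<open>s\<close> to
    each stack satisfying \<Delta>.\<close>
  ultimately have "entails (pure_fml \<Delta>) (beta A B)"
    using s sat_same_order by (metis entails_def)
  \<comment> \<open>The witness is \<open>s\<close> itself, since only atoms true at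
    \<open>s\<close> were put into \<Delta>.\<close>
  moreover have "satisfiable (pure_fml \<Delta>)"
    using \<Delta> sat_\<Delta> by (auto simp: satisfiable_def)
  \<comment> \<open>Completeness of the seed is trichotomy of the values at
    \<open>s\<close>.\<close>
  moreover have "\<exists>\<delta> \<in> set \<Delta>. \<delta> = Lt t u \<or> \<delta> = Lt u t \<or> \<delta> = Eq t u" if "t \<in> T" "u \<in> T" for t u
    using that
    by (cases "eval_trm s t" "eval_trm s u" rule: linorder_cases) (force simp: \<Delta>)+
  ultimately have "solution_seed A B \<Delta>"
    using \<Delta> by (auto simp: solution_seed_def T_def)
  then show ?thesis ..
qed

end
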